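(* Let $(X,d)$ be a metric space and let $f:X\to X$ be an $F_c$-contraction with $u_0\in X$. Define the number $\sigma$ by $$\sigma=\inf\{d(u,fu): u\ne fu,\ u\in X\}.$$ Then $C_{u_0,\sigma}$ is a fixed circle of $f$. In particular, $f$ fixes every circle $C_{u_0,r}$ where $r<\sigma$.
   Context: Let $\mathbb{F}$ be the family of all functions $F:(0,\infty)\to\mathbb{R}$ such that: $(F_1)$ $F$ is strictly increasing; $(F_2)$ for each sequence $\{\alpha_n\}$ in $(0,\infty)$, $\lim_{n\to\infty}\alpha_n=0$ if and only if $\lim_{n\to\infty}F(\alpha_n)=-\infty$; $(F_3)$ there exists $k\in(0,1)$ such that $\lim_{\alpha\to0^+}\alpha^kF(\alpha)=0$. A self-mapping $f$ of a metric space $(X,d)$ is an $F_c$-contraction with $u_0\in X$ if there exist $t>0$ and $F\in\mathbb{F}$ such that for all $u\in X$: $d(u,fu)>0$ implies $t+F(d(u,fu))\le F(d(u_0,u))$. Since $F$ is defined only on $(0,\infty)$, the implication is understood to require in particular that $d(u_0,u)>0$ whenever $d(u,fu)>0$. For $u_0\in X$ and a radius $r\geq 0$, the circle is $C_{u_0,r}=\{u\in X: d(u,u_0)=r\}$. It is a fixed circle of $f$ (i.e. $f$ fixes it) if $fu=u$ for all $u\in C_{u_0,r}$. Here $fu$ denotes $f(u)$. *)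

theory Defs
  imports Complex_Main "HOL-Library.Extended_Real"
begin

text \<open>Functions on \<open>(0, \<infinity>)\<close> are represented as functions on all reals whose values outside
  \<open>(0, \<infinity>)\<close> are irrelevant.\<close>

definition F_family :: "(real \<Rightarrow> real) set" where
  "F_family = {F.
     strict_mono_on {0<..} F \<and>
     (\<forall>\<alpha> :: nat \<Rightarrow> real. (\<forall>n. \<alpha> n > 0) \<longrightarrow>
        (\<alpha> \<longlonglongrightarrow> 0 \<longleftrightarrow> filterlim (\<lambda>n. F (\<alpha> n)) at_bot sequentially)) \<and>
     (\<exists>k\<in>{0<..<1}. ((\<lambda>a. a powr k * F a) \<longlongrightarrow> 0) (at_right 0))}"

text \<open>The conjunct \<open>dist u0 u > 0\<close> makes explicit that \<open>F\<close> is evaluated only inside its domain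
  \<open>(0, \<infinity>)\<close>.\<close>

definition Fc_contraction :: "('a::metric_space \<Rightarrow> 'a) \<Rightarrow> 'a \<Rightarrow> bool" where
  "Fc_contraction f u0 \<longleftrightarrow>
     (\<exists>t>0. \<exists>F\<in>F_family. \<forall>u. dist u (f u) > 0 \<longrightarrow>
        dist u0 u > 0 \<and> t + F (dist u (f u)) \<le> F (dist u0 u))"

definition circle :: "'a::metric_space \<Rightarrow> real \<Rightarrow> 'a set" where
  "circle u0 r = {u. dist u u0 = r}"

definition fixed_circle :: "('a::metric_space \<Rightarrow> 'a) \<Rightarrow> 'a \<Rightarrow> real \<Rightarrow> bool" where
  "fixed_circle f u0 r \<longleftrightarrow> (\<forall>u\<in>circle u0 r. f u = u)"

text \<open>The infimum is taken in the extended reals, so that it is \<open>\<infinity>\<close> when \<open>f\<close> is the identity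
  (on the reals, \<open>Inf {}\<close> would be an unspecified number); otherwise it is a nonnegative real.\<close>

definition sigma :: "('a::metric_space \<Rightarrow> 'a) \<Rightarrow> ereal" where
  "sigma f = Inf {ereal (dist u (f u)) | u. u \<noteq> f u}"

end

theory Submission
  imports Defs
begin

text \<open>As t > 0 and F is strictly increasing, the contraction inequality forces a moved point u
  to satisfy d(u,fu) < d(u0,u) (\<open>Fc_contraction_dist_less\<close>). But d(u,fu) is at least
  \<open>sigma f\<close>, so every moved point lies farther than \<open>sigma f\<close> from
  u0.\<close>

lemma Fc_contraction_dist_less:
  assumes "Fc_contraction f u0" and "u \<noteq> f u"
  shows "dist u (f u) < dist u0 u"
proof -
  obtain t F where t: "t > 0" and "F \<in> F_family"
    and c: "\<And>u. dist u (f u) > 0 \<Longrightarrow>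
              dist u0 u > 0 \<and> t + F (dist u (f u)) \<le> F (dist u0 u)"
    using assms(1) unfolding Fc_contraction_def by blast
  then have F: "strict_mono_on {0<..} F" by (simp add: F_family_def)
  have pos: "dist u (f u) > 0" using assms(2) by simp
  have "F (dist u (f u)) < F (dist u0 u)" using c[OF pos] t by linarith
  \<comment> \<open>F reflects the order only on (0,\<infinity>), so both distances must be
    positive; for \<open>dist u0 u\<close> this comes from the contraction condition.\<close>
  then show ?thesis
    using strict_mono_on_less[OF F] pos c[OF pos] by simp
qed

lemma sigma_le_dist: "u \<noteq> f u \<Longrightarrow> sigma f \<le> ereal (dist u (f u))"
  unfolding sigma_def by (rule Inf_lower) blast

text \<open>The strictness of d(u,fu) < d(u0,u) is what admits the boundary radius, so r = \<sigma>
  and r < \<sigma> are handled together. A moved point on the circle would give r \<le> d(u,fu) <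
  r.\<close>

lemma fixed_circle_if_le_sigma:
  assumes "Fc_contraction f u0" and "ereal r \<le> sigma f"
  shows "fixed_circle f u0 r"
  unfolding fixed_circle_def
proof (intro ballI, rule ccontr)
  fix u assume u: "u \<in> circle u0 r" and "f u \<noteq> u"
  then have ne: "u \<noteq> f u" by simp
  have "ereal r \<le> ereal (dist u (f u))"
    using assms(2) sigma_le_dist[of u f, OF ne] by (rule order_trans)
  moreover have "dist u (f u) < r"
    using Fc_contraction_dist_less[OF assms(1) ne] u by (simp add: circle_def dist_commute)
  ultimately show False by simp
qed

theorem theorem3p4:
  fixes f :: "'a::metric_space \<Rightarrow> 'a" and u0 :: 'a
  assumes "Fc_contraction f u0"
  shows "(\<forall>r\<ge>0. ereal r = sigma f \<longrightarrow> fixed_circle f u0 r) \<and>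
         (\<forall>r\<ge>0. ereal r < sigma f \<longrightarrow> fixed_circle f u0 r)"
  using fixed_circle_if_le_sigma[OF assms] by (simp add: less_imp_le)

end
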